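(* Let $X=(X_1,\dots,X_p)$ be a random vector in $\mathbb{R}^p$ with strictly positive, $p+1$ times continuously differentiable density $f_X$. Let $i,j\in\{1,\dots,p\}$ with $i\neq j$, let $k=e_i+e_j$, and let $X_{-ij}$ denote the vector of all components of $X$ other than $X_i$ and $X_j$. Then $X_i$ and $X_j$ are conditionally independent given $X_{-ij}$ if and only if $\kappa_k^x=0$ for all $x\in\mathbb{R}^p$.
   Context: $e_i$ is the $i$-th standard unit vector of $\mathbb{R}^p$. For $k=e_i+e_j$ with $i\ne j$, the differential cumulant at $x$ is $\kappa_k^x=\frac{\partial^2}{\partial x_i\partial x_j}\log f_X(x)$. *)

theory Defs
  imports "HOL-Probability.Probability"
begin

definition has_partial_deriv :: "(real ^ 'n \<Rightarrow> real) \<Rightarrow> 'n \<Rightarrow> real ^ 'n \<Rightarrow> bool" where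
  "has_partial_deriv g l x \<longleftrightarrow> (\<lambda>t. g (x + t *\<^sub>R axis l 1)) field_differentiable (at 0)"

definition partial_deriv :: "'n \<Rightarrow> (real ^ 'n \<Rightarrow> real) \<Rightarrow> real ^ 'n \<Rightarrow> real" where
  "partial_deriv l g x = deriv (\<lambda>t. g (x + t *\<^sub>R axis l 1)) 0"

(* All iterated partial derivatives of order at most m exist everywhere and are continuous. *)
fun times_cont_diff :: "nat \<Rightarrow> (real ^ 'n \<Rightarrow> real) \<Rightarrow> bool" where
  "times_cont_diff 0 g \<longleftrightarrow> continuous_on UNIV g"
| "times_cont_diff (Suc m) g \<longleftrightarrow> continuous_on UNIV g \<and>
     (\<forall>l. (\<forall>x. has_partial_deriv g l x) \<and> times_cont_diff m (partial_deriv l g))"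

(* The differential cumulant of order e_i + e_j (for i and j distinct) of the density f. *)
definition diff_cumulant :: "(real ^ 'n \<Rightarrow> real) \<Rightarrow> 'n \<Rightarrow> 'n \<Rightarrow> real ^ 'n \<Rightarrow> real" where
  "diff_cumulant f i j x = partial_deriv i (partial_deriv j (\<lambda>y. ln (f y))) x"

definition cond_prob_given ::
    "'w measure \<Rightarrow> 'c measure \<Rightarrow> ('w \<Rightarrow> 'c) \<Rightarrow> 'w set \<Rightarrow> 'w \<Rightarrow> real" where
  "cond_prob_given M U Z E = real_cond_exp M (vimage_algebra (space M) Z U) (indicator E)"

definition cond_indep_var ::
    "'w measure \<Rightarrow> 'a measure \<Rightarrow> ('w \<Rightarrow> 'a) \<Rightarrow> 'b measure \<Rightarrow> ('w \<Rightarrow> 'b) \<Rightarrow>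
     'c measure \<Rightarrow> ('w \<Rightarrow> 'c) \<Rightarrow> bool" where
  "cond_indep_var M S X T Y U Z \<longleftrightarrow>
     X \<in> measurable M S \<and> Y \<in> measurable M T \<and> Z \<in> measurable M U \<and>
     (\<forall>A\<in>sets S. \<forall>B\<in>sets T. AE w in M.
        cond_prob_given M U Z ((X -` A \<inter> space M) \<inter> (Y -` B \<inter> space M)) w =
        cond_prob_given M U Z (X -` A \<inter> space M) w *
        cond_prob_given M U Z (Y -` B \<inter> space M) w)"

(* The subvector of x with components indexed by I, a point of the product space over I. *)
definition subvector :: "'n set \<Rightarrow> real ^ 'n \<Rightarrow> 'n \<Rightarrow> real" where
  "subvector I x = (\<lambda>l\<in>I. x $ l)"

end

theory Submission
  imports Defs
begin

text \<open>
  Both conditions are equivalent to the rectangle identity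
  f(x + s e_i + t e_j) f(x) = f(x + s e_i) f(x + t e_j) for all x, s, t.
  For the differential cumulant this is integration of the mixed derivative of log f.
  For conditional independence, let H_z(W) be the integral over W of (a, b) against the density f
  at the point with coordinates a, b and remaining coordinates z. The conditional probability of
  (X_i, X_j) being in W is H_z(W) / H_z(R^2), so the rectangle identity gives independence by
  Tonelli. Conversely, independence gives
  H_z(A x B) H_z(A' x B') = H_z(A x B') H_z(A' x B) for almost all z. If the rectangle identity fails
  at one point, then by continuity of f this relation fails for suitable small intervals
  A, A', B, B' and all z in a cube, which is not a null set. No continuity of the
  marginal densities is needed.
\<close>

subsection \<open>Partial derivatives along coordinate lines\<close>

lemma has_partial_deriv_iff:
  "has_partial_deriv g l x \<longleftrightarrow>
     ((\<lambda>t. g (x + t *\<^sub>R axis l 1)) has_field_derivative partial_deriv l g x) (at 0)"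
  by (simp add: has_partial_deriv_def partial_deriv_def DERIV_deriv_iff_field_differentiable)

text \<open>The restriction of \<open>g\<close> to the line has at parameter \<open>s\<close> the
  partial derivative of \<open>g\<close> at the shifted base point as its derivative. This is zero
  for every \<open>s\<close>, so the restriction is constant.\<close>

lemma const_along_line:
  fixes g :: "real ^ 'n \<Rightarrow> real"
  assumes "\<And>x. has_partial_deriv g l x" "\<And>x. partial_deriv l g x = 0"
  shows "g (x + s *\<^sub>R axis l 1) = g x"
proof -
  have "((\<lambda>s. g (x + s *\<^sub>R axis l 1)) has_field_derivative 0) (at s)" for s
  proof -
    have "((\<lambda>t. g ((x + s *\<^sub>R axis l 1) + t *\<^sub>R axis l 1)) has_field_derivative 0) (at 0)"
      using assms[of "x + s *\<^sub>R axis l 1"] by (simp add: has_partial_deriv_iff)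
    then have "((\<lambda>t. g (x + (t + s) *\<^sub>R axis l 1)) has_field_derivative 0) (at 0)"
      by (simp add: algebra_simps)
    then show ?thesis
      using DERIV_shift[of "\<lambda>t. g (x + t *\<^sub>R axis l 1)" 0 0 s] by simp
  qed
  then have "(\<lambda>s. g (x + s *\<^sub>R axis l 1)) s = (\<lambda>s. g (x + s *\<^sub>R axis l 1)) 0"
    using DERIV_isconst_all by blast
  then show ?thesis by simp
qed

lemma has_partial_derivI:
  assumes "((\<lambda>t. g (x + t *\<^sub>R axis l 1)) has_field_derivative d) (at 0)"
  shows "has_partial_deriv g l x" "partial_deriv l g x = d"
  using assms DERIV_imp_deriv
  by (auto simp: has_partial_deriv_def partial_deriv_def field_differentiable_def)

text \<open>After taking logarithms the rectangle identity says that the second difference of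
  \<open>L = ln f\<close> in the directions \<open>i\<close> and \<open>j\<close> vanishes. A
  vanishing mixed derivative gives this by applying \<open>const_along_line\<close> twice, first
  along \<open>i\<close> and then along \<open>j\<close>.\<close>

lemma diff_cumulant_eq_0_iff:
  fixes f :: "real ^ 'n \<Rightarrow> real"
  assumes pos: "\<And>x. 0 < f x" and C: "times_cont_diff (Suc (Suc m)) f"
  shows "(\<forall>x. diff_cumulant f i j x = 0) \<longleftrightarrow>
         (\<forall>x s t. f (x + s *\<^sub>R axis i 1 + t *\<^sub>R axis j 1) * f x =
                  f (x + s *\<^sub>R axis i 1) * f (x + t *\<^sub>R axis j 1))"
proof
  define L where "L = (\<lambda>y. ln (f y))"
  have dj: "has_partial_deriv L j x" "partial_deriv j L x = partial_deriv j f x / f x" for x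
  proof -
    have "has_partial_deriv f j x" using C by auto
    then have "((\<lambda>t. L (x + t *\<^sub>R axis j 1)) has_field_derivative
        partial_deriv j f x / f x) (at 0)"
      unfolding has_partial_deriv_iff L_def using pos[of x]
      by (auto intro!: derivative_eq_intros)
    then show "has_partial_deriv L j x" "partial_deriv j L x = partial_deriv j f x / f x"
      by (rule has_partial_derivI)+
  qed
  have djeq: "partial_deriv j L = (\<lambda>x. partial_deriv j f x / f x)" using dj by auto
  \<comment> \<open>\<open>deriv\<close> is a total function, so a zero value of the cumulant does
    not by itself give differentiability. It comes from the quotient formula for
    \<open>partial_deriv j L\<close>.\<close>
  have dij: "has_partial_deriv (partial_deriv j L) i x" for x
  proof -
    have "has_partial_deriv f i x" "has_partial_deriv (partial_deriv j f) i x"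
      using C by auto
    then have "((\<lambda>t. partial_deriv j f (x + t *\<^sub>R axis i 1) / f (x + t *\<^sub>R axis i 1)) has_field_derivative
       (partial_deriv i (partial_deriv j f) x * f x - partial_deriv j f x * partial_deriv i f x) / (f x * f x)) (at 0)"
      unfolding has_partial_deriv_iff using pos[of x]
      by (auto intro!: derivative_eq_intros)
    then show ?thesis unfolding djeq by (rule has_partial_derivI)
  qed
  {
    assume "\<forall>x. diff_cumulant f i j x = 0"
    then have u: "partial_deriv j L (x + s *\<^sub>R axis i 1) = partial_deriv j L x" for x s
      by (intro const_along_line dij) (simp add: diff_cumulant_def L_def)
    show "\<forall>x s t. f (x + s *\<^sub>R axis i 1 + t *\<^sub>R axis j 1) * f x =
                  f (x + s *\<^sub>R axis i 1) * f (x + t *\<^sub>R axis j 1)"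
    proof (intro allI)
      fix x s t
      \<comment> \<open>\<open>G\<close> is the increment of \<open>L\<close> in direction
        \<open>i\<close>. Its derivative in direction \<open>j\<close> is a difference of two values
        of \<open>partial_deriv j L\<close>, which \<open>u\<close> makes equal.\<close>
      define G where "G y = L (y + s *\<^sub>R axis i 1) - L y" for y
      have G: "((\<lambda>t. G (y + t *\<^sub>R axis j 1)) has_field_derivative 0) (at 0)" for y
      proof -
        have "((\<lambda>t. L ((y + s *\<^sub>R axis i 1) + t *\<^sub>R axis j 1) - L (y + t *\<^sub>R axis j 1)) has_field_derivative
            partial_deriv j L (y + s *\<^sub>R axis i 1) - partial_deriv j L y) (at 0)"
          using dj(1) unfolding has_partial_deriv_iff by (intro DERIV_diff) auto
        then show ?thesis by (simp add: G_def u algebra_simps)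
      qed
      have "G (x + t *\<^sub>R axis j 1) = G x"
        by (rule const_along_line has_partial_derivI G)+
      then have "L (x + s *\<^sub>R axis i 1 + t *\<^sub>R axis j 1) + L x = L (x + s *\<^sub>R axis i 1) + L (x + t *\<^sub>R axis j 1)"
        by (simp add: G_def algebra_simps)
      then have "ln (f (x + s *\<^sub>R axis i 1 + t *\<^sub>R axis j 1) * f x) = ln (f (x + s *\<^sub>R axis i 1) * f (x + t *\<^sub>R axis j 1))"
        using pos by (simp add: L_def ln_mult_pos)
      then show "f (x + s *\<^sub>R axis i 1 + t *\<^sub>R axis j 1) * f x =
                  f (x + s *\<^sub>R axis i 1) * f (x + t *\<^sub>R axis j 1)"
        using pos by (subst (asm) ln_inj_iff) auto
    qed
  next
    assume R: "\<forall>x s t. f (x + s *\<^sub>R axis i 1 + t *\<^sub>R axis j 1) * f x =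
                  f (x + s *\<^sub>R axis i 1) * f (x + t *\<^sub>R axis j 1)"
    \<comment> \<open>As functions of \<open>t\<close>, \<open>L\<close> along the shifted line and
      \<open>L\<close> along the original line differ by a constant, so their derivatives at 0
      agree. The derivative along \<open>i\<close> is then that of a constant.\<close>
    have "partial_deriv j L (x + s *\<^sub>R axis i 1) = partial_deriv j L x" for x s
    proof (rule has_partial_derivI(2))
      have "L (x + s *\<^sub>R axis i 1 + t *\<^sub>R axis j 1) = L (x + t *\<^sub>R axis j 1) + (L (x + s *\<^sub>R axis i 1) - L x)" for t
      proof -
        have "ln (f (x + s *\<^sub>R axis i 1 + t *\<^sub>R axis j 1) * f x) = ln (f (x + s *\<^sub>R axis i 1) * f (x + t *\<^sub>R axis j 1))"
          using R by simp
        then have "L (x + s *\<^sub>R axis i 1 + t *\<^sub>R axis j 1) + L x = L (x + s *\<^sub>R axis i 1) + L (x + t *\<^sub>R axis j 1)"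
          using pos by (simp add: L_def ln_mult_pos)
        then show ?thesis by linarith
      qed
      then show "((\<lambda>t. L (x + s *\<^sub>R axis i 1 + t *\<^sub>R axis j 1)) has_field_derivative partial_deriv j L x) (at 0)"
        using dj(1)[of x] unfolding has_partial_deriv_iff by (auto intro!: derivative_eq_intros)
    qed
    then show "\<forall>x. diff_cumulant f i j x = 0"
      unfolding diff_cumulant_def L_def[symmetric]
      by (intro allI has_partial_derivI(2)) simp
  }
qed

subsection \<open>Conditional probabilities from a joint density\<close>

text \<open>An unnormalised conditional law of the first variable. For \<open>W = space S\<close> it
  is the marginal density of the second variable; values in \<open>ennreal\<close> admit slices of
  infinite mass.\<close>

definition slice_mass :: "'v measure \<Rightarrow> ('v \<times> 'z \<Rightarrow> ennreal) \<Rightarrow> 'v set \<Rightarrow> 'z \<Rightarrow> ennreal" where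
  "slice_mass S h W z = (\<integral>\<^sup>+ v. h (v, z) * indicator W v \<partial>S)"

lemma slice_mass_space: "slice_mass S h (space S) z = (\<integral>\<^sup>+ v. h (v, z) \<partial>S)"
  unfolding slice_mass_def by (auto intro!: nn_integral_cong)

lemma slice_mass_le_space: "slice_mass S h W z \<le> slice_mass S h (space S) z"
  unfolding slice_mass_def by (auto intro!: nn_integral_mono split: split_indicator)

lemma measurable_slice_mass:
  assumes "sigma_finite_measure S"
    and [measurable]: "h \<in> borel_measurable (S \<Otimes>\<^sub>M U)" "W \<in> sets S"
  shows "slice_mass S h W \<in> borel_measurable U"
proof -
  interpret sigma_finite_measure S by fact
  show ?thesis unfolding slice_mass_def[abs_def] by measurable
qed

lemma slice_mass_ge:
  assumes "W \<in> sets S" "\<And>v. v \<in> W \<Longrightarrow> c \<le> h (v, z)"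
  shows "c * emeasure S W \<le> slice_mass S h W z"
proof -
  have "c * emeasure S W = (\<integral>\<^sup>+ v. c * indicator W v \<partial>S)"
    using assms(1) by (simp add: nn_integral_cmult_indicator)
  also have "\<dots> \<le> slice_mass S h W z"
    unfolding slice_mass_def using assms(2) by (intro nn_integral_mono) (auto split: split_indicator)
  finally show ?thesis .
qed

lemma slice_mass_le:
  assumes "W \<in> sets S" "\<And>v. v \<in> W \<Longrightarrow> h (v, z) \<le> c"
  shows "slice_mass S h W z \<le> c * emeasure S W"
proof -
  have "slice_mass S h W z \<le> (\<integral>\<^sup>+ v. c * indicator W v \<partial>S)"
    unfolding slice_mass_def using assms(2) by (intro nn_integral_mono) (auto split: split_indicator)
  also have "\<dots> = c * emeasure S W"
    using assms(1) by (simp add: nn_integral_cmult_indicator)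
  finally show ?thesis .
qed

context prob_space
begin

lemma distributed_slice_mass:
  assumes S: "sigma_finite_measure S" and U: "sigma_finite_measure U"
    and D: "distributed M (S \<Otimes>\<^sub>M U) (\<lambda>w. (V w, Z w)) h"
  shows "distributed M U Z (slice_mass S h (space S))"
  using distr_marginal2[OF S U D] by (simp add: slice_mass_space[abs_def])

text \<open>The total slice mass is the density of \<open>Z\<close>, so its integral is 1 and it can
  be infinite only on a null set.\<close>

lemma AE_slice_mass_finite:
  assumes S: "sigma_finite_measure S" and U: "sigma_finite_measure U"
    and D: "distributed M (S \<Otimes>\<^sub>M U) (\<lambda>w. (V w, Z w)) h"
  shows "AE z in U. slice_mass S h (space S) z < \<infinity>"
proof -
  note DZ = distributed_slice_mass[OF assms]
  have "(\<integral>\<^sup>+ z. slice_mass S h (space S) z \<partial>U) = (\<integral>\<^sup>+ w. 1 \<partial>M)"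
    using distributed_nn_integral[OF DZ, of "\<lambda>_. 1"] by simp
  also have "\<dots> \<noteq> \<infinity>" by (simp add: emeasure_space_1)
  finally have "AE z in U. slice_mass S h (space S) z \<noteq> \<infinity>"
    by (intro nn_integral_PInf_AE distributed_borel_measurable[OF DZ])
  then show ?thesis by (simp add: less_top)
qed

text \<open>The quotient is a bounded measurable function of \<open>Z\<close>. It is the conditional
  expectation because both have the same integral over each event \<open>Z \<in> C\<close>: by
  Tonelli, this is the integral over \<open>C\<close> of the slice mass of \<open>W\<close>.\<close>

lemma cond_prob_given_eq_slice_mass:
  assumes S: "sigma_finite_measure S" and U: "sigma_finite_measure U"
    and D: "distributed M (S \<Otimes>\<^sub>M U) (\<lambda>w. (V w, Z w)) h"
    and W [measurable]: "W \<in> sets S"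
  shows "AE w in M. cond_prob_given M U Z (V -` W \<inter> space M) w =
           enn2real (slice_mass S h W (Z w)) / enn2real (slice_mass S h (space S) (Z w))"
proof -
  interpret S: sigma_finite_measure S by fact
  interpret U: sigma_finite_measure U by fact
  interpret SU: pair_sigma_finite S U ..
  note DZ = distributed_slice_mass[OF S U D]
  have h [measurable]: "h \<in> borel_measurable (S \<Otimes>\<^sub>M U)"
    and VZ: "(\<lambda>w. (V w, Z w)) \<in> measurable M (S \<Otimes>\<^sub>M U)"
    using D by (auto simp: distributed_def)
  have V [measurable]: "V \<in> measurable M S" and Z [measurable]: "Z \<in> measurable M U"
    using measurable_fst'[OF VZ] measurable_snd'[OF VZ] by simp_all
  note [measurable] = measurable_slice_mass[OF S h]
  define F where "F = vimage_algebra (space M) Z U"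
  define E where "E = V -` W \<inter> space M"
  define K where "K z = enn2real (slice_mass S h W z) / enn2real (slice_mass S h (space S) z)" for z
  have E [measurable]: "E \<in> sets M" unfolding E_def by measurable
  have K [measurable]: "K \<in> borel_measurable U" unfolding K_def[abs_def] by measurable
  have K0: "0 \<le> K z" for z by (simp add: K_def)
  have sub: "subalgebra M F"
    unfolding subalgebra_def F_def using sets_image_in_sets[OF refl Z] by simp
  interpret F: finite_measure_subalgebra M F
    by standard fact
  have ZF: "Z \<in> measurable F U"
    unfolding F_def using measurable_space[OF Z] by (intro measurable_vimage_algebra1) auto
  have K1: "K z \<le> 1" if "slice_mass S h (space S) z < \<infinity>" for z
    using enn2real_mono[OF slice_mass_le_space[of S h W z]] that enn2real_nonneg[of "slice_mass S h W z"]
    unfolding K_def by (auto simp: divide_le_eq_1 less_le)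
  \<comment> \<open>Integrability of \<open>K (Z w)\<close> follows from this bound; the density of
    \<open>Z\<close> carries it from \<open>U\<close> to \<open>M\<close>.\<close>
  have AEK: "AE w in M. norm (K (Z w)) \<le> 1"
  proof -
    have "AE z in U. slice_mass S h (space S) z < \<infinity>" by (rule AE_slice_mass_finite[OF S U D])
    then have "AE z in U. 0 < slice_mass S h (space S) z \<longrightarrow> K z \<le> 1"
      by eventually_elim (auto intro: K1)
    then have "AE w in M. K (Z w) \<le> 1"
      by (subst distributed_AE2[OF DZ]) simp_all
    then show ?thesis using K0 by simp
  qed
  have "AE w in M. real_cond_exp M F (indicator E) w = K (Z w)"
  proof (rule F.real_cond_exp_charact)
    show "integrable M (indicat_real E)" by (simp add: E finite_emeasure_space emeasure_eq_measure)
    show "integrable M (\<lambda>w. K (Z w))"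
      using AEK by (intro integrable_const_bound[where B = 1]) measurable
    show "(\<lambda>w. K (Z w)) \<in> borel_measurable F" using ZF K by (rule measurable_compose)
  next
    fix A assume "A \<in> sets F"
    then obtain C where C [measurable]: "C \<in> sets U" and A: "A = Z -` C \<inter> space M"
      unfolding F_def using measurable_space[OF Z] by (subst (asm) sets_vimage_algebra2) auto
    have A' [measurable]: "A \<in> sets M" unfolding A by measurable
    have "(\<integral>\<^sup>+ w. ennreal (indicator A w * indicator E w) \<partial>M)
        = (\<integral>\<^sup>+ w. indicator W (fst (V w, Z w)) * indicator C (snd (V w, Z w)) \<partial>M)"
      by (rule nn_integral_cong) (auto simp: A E_def split: split_indicator)
    also have "\<dots> = (\<integral>\<^sup>+ x. h x * (indicator W (fst x) * indicator C (snd x)) \<partial>(S \<Otimes>\<^sub>M U))"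
      by (rule distributed_nn_integral[OF D, symmetric]) measurable
    also have "\<dots> = (\<integral>\<^sup>+ z. \<integral>\<^sup>+ v. h (v, z) * (indicator W v * indicator C z) \<partial>S \<partial>U)"
      by (subst SU.nn_integral_snd[symmetric]) simp_all
    also have "\<dots> = (\<integral>\<^sup>+ z. slice_mass S h W z * indicator C z \<partial>U)"
      unfolding slice_mass_def
      by (intro nn_integral_cong, subst nn_integral_multc[symmetric]) (simp_all add: mult.assoc)
    also have "\<dots> = (\<integral>\<^sup>+ z. slice_mass S h (space S) z * ennreal (indicator C z * K z) \<partial>U)"
    proof (rule nn_integral_cong_AE)
      show "AE z in U. slice_mass S h W z * indicator C z
          = slice_mass S h (space S) z * ennreal (indicator C z * K z)"
        using AE_slice_mass_finite[OF S U D]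
      proof eventually_elim
        case (elim z)
        define s where "s = enn2real (slice_mass S h W z)"
        define t where "t = enn2real (slice_mass S h (space S) z)"
        have le: "slice_mass S h W z \<le> slice_mass S h (space S) z" by (rule slice_mass_le_space)
        have st: "slice_mass S h W z = ennreal s" "slice_mass S h (space S) z = ennreal t"
          using elim le by (auto simp: s_def t_def)
        have "0 \<le> s" "0 \<le> t" "s \<le> t"
          using le enn2real_mono[OF le] elim by (auto simp: s_def t_def)
        moreover have "K z = s / t" by (simp add: K_def s_def t_def)
        \<comment> \<open>If the marginal density \<open>t\<close> is 0, then
          \<open>s \<le> t\<close> forces \<open>s = 0\<close>, so both sides vanish despite the
          division by zero in \<open>K z\<close>.\<close>
        ultimately show ?case unfolding st
          by (cases "t = 0") (auto simp: ennreal_mult[symmetric] split: split_indicator)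
      qed
    qed
    also have "\<dots> = (\<integral>\<^sup>+ w. ennreal (indicator C (Z w) * K (Z w)) \<partial>M)"
      by (rule distributed_nn_integral[OF DZ]) measurable
    also have "\<dots> = (\<integral>\<^sup>+ w. ennreal (indicator A w * K (Z w)) \<partial>M)"
      by (rule nn_integral_cong) (auto simp: A split: split_indicator)
    finally have eq: "(\<integral>\<^sup>+ w. ennreal (indicator A w * indicator E w) \<partial>M)
        = (\<integral>\<^sup>+ w. ennreal (indicator A w * K (Z w)) \<partial>M)" .
    show "(LINT w:A|M. indicator E w) = (LINT w:A|M. K (Z w))"
      unfolding set_lebesgue_integral_def real_scaleR_def
      by (subst (1 2) integral_eq_nn_integral) (auto simp: eq K0)
  qed
  then show ?thesis by (simp add: cond_prob_given_def F_def E_def K_def)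
qed

end

subsection \<open>Splitting off two coordinates of Lebesgue measure\<close>

text \<open>The reassembly map, inverse to splitting a vector into coordinates \<open>i\<close>,
  \<open>j\<close> and the rest when \<open>i \<noteq> j\<close>. Values of the third argument at
  \<open>i\<close> and \<open>j\<close> are ignored.\<close>

definition insert_coords :: "'n \<Rightarrow> 'n \<Rightarrow> (real \<times> real) \<times> ('n \<Rightarrow> real) \<Rightarrow> real ^ 'n" where
  "insert_coords i j q = (\<chi> l. if l = i then fst (fst q) else if l = j then snd (fst q) else snd q l)"

abbreviation rest_lborel :: "'n \<Rightarrow> 'n \<Rightarrow> ('n \<Rightarrow> real) measure" where
  "rest_lborel i j \<equiv> PiM (- {i, j}) (\<lambda>_. lborel)"

text \<open>Conditioning uses the Borel sigma-algebra on the remaining coordinates, whereas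
  densities refer to Lebesgue measure there; this allows passing between the two.\<close>

lemma sets_borel_rest [measurable_cong]: "sets (rest_lborel i j) = sets (PiM (- {i, j}) (\<lambda>_. borel))"
  by (intro sets_PiM_cong) auto

lemma sigma_finite_rest_lborel:
  "sigma_finite_measure (rest_lborel i (j :: 'n :: finite))"
proof -
  interpret product_sigma_finite "\<lambda>_ :: 'n. lborel :: real measure" ..
  show ?thesis by (rule sigma_finite) simp
qed

lemma sigma_finite_lborel_pair: "sigma_finite_measure (lborel \<Otimes>\<^sub>M (lborel :: real measure))"
  unfolding lborel_prod by (rule sigma_finite_lborel)

lemma measurable_vec_nth [measurable]: "(\<lambda>x :: real ^ 'n. x $ l) \<in> borel_measurable borel"
  by (intro borel_measurable_continuous_onI continuous_intros)

lemma measurable_subvector [measurable]: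
  "subvector I \<in> measurable borel (PiM I (\<lambda>_. borel))"
  unfolding subvector_def[abs_def] by measurable

lemma measurable_insert_coords [measurable]:
  "insert_coords i j \<in> borel_measurable ((lborel \<Otimes>\<^sub>M lborel) \<Otimes>\<^sub>M rest_lborel i (j :: 'n :: finite))"
    (is "_ \<in> borel_measurable ?Q")
proof (subst borel_measurable_euclidean_space, intro ballI)
  fix b :: "real ^ 'n" assume "b \<in> Basis"
  then obtain l where b: "b = axis l 1" by (auto simp: Basis_vec_def)
  have "(\<lambda>q. if l = i then fst (fst q) else if l = j then snd (fst q) else snd q l)
      \<in> borel_measurable ?Q"
  proof -
    consider "l = i" | "l \<noteq> i" "l = j" | "l \<in> - {i, j}" by auto
    then show ?thesis
    proof cases
      case 3
      then have "(\<lambda>q. snd q l) \<in> borel_measurable ?Q"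
        by (intro measurable_compose[OF measurable_snd]) simp
      then show ?thesis using 3 by simp
    qed simp_all
  qed
  then show "(\<lambda>q. insert_coords i j q \<bullet> b) \<in> borel_measurable ?Q"
    by (simp add: b inner_axis insert_coords_def)
qed

text \<open>Lebesgue measure is determined by the volumes of boxes. The preimage of a box imposes
  one interval condition per coordinate, so it is a product set whose measure is the product of all
  side lengths.\<close>

lemma distr_insert_coords:
  assumes "i \<noteq> (j :: 'n :: finite)"
  shows "distr ((lborel \<Otimes>\<^sub>M lborel) \<Otimes>\<^sub>M rest_lborel i j) borel (insert_coords i j) = lborel"
    (is "distr ?Q _ _ = _")
proof (rule lborel_eqI[symmetric])
  fix l u :: "real ^ 'n"
  assume lu: "\<And>b. b \<in> Basis \<Longrightarrow> l \<bullet> b \<le> u \<bullet> b"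
  then have le: "l $ k \<le> u $ k" for k
    using lu[of "axis k 1"] by (simp add: inner_axis axis_in_Basis_iff)
  interpret P: product_sigma_finite "\<lambda>_ :: 'n. lborel :: real measure" ..
  interpret N: sigma_finite_measure "rest_lborel i j" by (rule sigma_finite_rest_lborel)
  let ?I = "\<lambda>k. {l $ k <..< u $ k}"
  have "insert_coords i j -` box l u \<inter> space ?Q = (?I i \<times> ?I j) \<times> PiE (- {i, j}) ?I"
  proof (intro set_eqI)
    fix q :: "(real \<times> real) \<times> ('n \<Rightarrow> real)"
    let ?P = "\<lambda>k. l $ k < insert_coords i j q $ k \<and> insert_coords i j q $ k < u $ k"
    have "(\<forall>k. ?P k) \<longleftrightarrow> ?P i \<and> ?P j \<and> (\<forall>k\<in>- {i, j}. ?P k)" by auto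
    also have "?P i \<longleftrightarrow> fst (fst q) \<in> ?I i" by (simp add: insert_coords_def)
    also have "?P j \<longleftrightarrow> snd (fst q) \<in> ?I j" using assms by (simp add: insert_coords_def)
    also have "(\<forall>k\<in>- {i, j}. ?P k) \<longleftrightarrow> (\<forall>k\<in>- {i, j}. snd q k \<in> ?I k)"
      by (intro ball_cong) (auto simp: insert_coords_def)
    finally show "q \<in> insert_coords i j -` box l u \<inter> space ?Q \<longleftrightarrow>
        q \<in> (?I i \<times> ?I j) \<times> PiE (- {i, j}) ?I"
      by (cases q) (simp add: mem_box_cart space_pair_measure space_PiM PiE_iff mem_Times_iff)
  qed
  then have "emeasure (distr ?Q borel (insert_coords i j)) (box l u)
      = emeasure ?Q ((?I i \<times> ?I j) \<times> PiE (- {i, j}) ?I)"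
    by (subst emeasure_distr) simp_all
  also have "\<dots> = emeasure lborel (?I i) * emeasure lborel (?I j) * emeasure (rest_lborel i j) (PiE (- {i, j}) ?I)"
    by (subst N.emeasure_pair_measure_Times)
      (auto simp: lborel.emeasure_pair_measure_Times intro!: sets_PiM_I_finite)
  also have "\<dots> = emeasure lborel (?I i) * emeasure lborel (?I j) * (\<Prod>k\<in>- {i, j}. emeasure lborel (?I k))"
    by (subst P.emeasure_PiM) auto
  also have "\<dots> = (\<Prod>k\<in>insert i (insert j (- {i, j})). ennreal (u $ k - l $ k))"
    using assms le by (simp add: mult.assoc)
  also have "insert i (insert j (- {i, j})) = UNIV" by auto
  also have "(\<Prod>k\<in>UNIV. ennreal (u $ k - l $ k)) = ennreal (\<Prod>k\<in>UNIV. u $ k - l $ k)"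
    using le by (intro prod_ennreal) simp
  also have "(\<Prod>k\<in>UNIV. u $ k - l $ k) = (\<Prod>b\<in>Basis. (u - l) \<bullet> b)"
    by (rule prod.reindex_bij_witness[of _ "\<lambda>b. axis_index b" "\<lambda>k. axis k 1"])
      (auto simp: inner_axis Basis_vec_def axis_index_axis)
  finally show "emeasure (distr ?Q borel (insert_coords i j)) (box l u) = ennreal (\<Prod>b\<in>Basis. (u - l) \<bullet> b)" .
qed simp

text \<open>Membership in the product space makes the last component extensional, which is what
  allows \<open>subvector\<close> to recover it exactly.\<close>

lemma insert_coords_inverse:
  assumes "i \<noteq> j" "q \<in> space ((lborel \<Otimes>\<^sub>M lborel) \<Otimes>\<^sub>M rest_lborel i j)"
  shows "((insert_coords i j q $ i, insert_coords i j q $ j), subvector (- {i, j}) (insert_coords i j q)) = q"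
proof -
  have ext: "snd q \<in> extensional (- {i, j})"
    using assms(2) by (cases q) (simp add: space_pair_measure space_PiM PiE_def)
  have "subvector (- {i, j}) (insert_coords i j q) = restrict (snd q) (- {i, j})"
    unfolding subvector_def by (rule restrict_ext) (simp add: insert_coords_def)
  also have "\<dots> = snd q" using ext by (rule extensional_restrict)
  finally have "subvector (- {i, j}) (insert_coords i j q) = snd q" .
  moreover have "insert_coords i j q $ i = fst (fst q)" by (simp add: insert_coords_def)
  moreover have "insert_coords i j q $ j = snd (fst q)" using assms(1) by (simp add: insert_coords_def)
  ultimately show ?thesis by (simp only: prod.collapse)
qed

text \<open>Lebesgue measure is the image of the product measure under \<open>insert_coords\<close>,
  and splitting undoes this map, so the density is transported without a Jacobian factor.\<close>

lemma distributed_coords: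
  fixes X :: "'w \<Rightarrow> real ^ 'n"
  assumes D: "distributed M lborel X f" and ij: "i \<noteq> j"
  shows "distributed M ((lborel \<Otimes>\<^sub>M lborel) \<Otimes>\<^sub>M rest_lborel i j)
     (\<lambda>w. ((X w $ i, X w $ j), subvector (- {i, j}) (X w))) (\<lambda>q. f (insert_coords i j q))"
    (is "distributed M ?Q _ _")
proof -
  define T where "T x = ((x $ i, x $ j), subvector (- {i, j}) x)" for x :: "real ^ 'n"
  have T [measurable]: "T \<in> measurable borel ?Q" unfolding T_def[abs_def] by measurable
  have f [measurable]: "f \<in> borel_measurable borel" and X [measurable]: "X \<in> measurable M borel"
    and eq: "distr M lborel X = density lborel f"
    using D by (auto simp: distributed_def)
  have "distr M ?Q (\<lambda>w. T (X w)) = distr (distr M lborel X) ?Q T"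
    by (subst distr_distr) (auto simp: comp_def)
  also have "\<dots> = distr (density (distr ?Q borel (insert_coords i j)) f) ?Q T"
    by (simp add: eq distr_insert_coords[OF ij])
  also have "\<dots> = density ?Q (f \<circ> insert_coords i j)"
    using insert_coords_inverse[OF ij]
    by (intro distr_density_distr) (auto simp: T_def)
  finally show ?thesis
    unfolding distributed_def T_def[symmetric] by (auto simp: comp_def)
qed

subsection \<open>Conditional independence and rectangles\<close>

text \<open>Cubes match the interval conditions on single coordinates used later, and the eventual
  form lets finitely many points share one radius.\<close>

lemma continuous_cube_nbhd:
  fixes f :: "real ^ 'n \<Rightarrow> real"
  assumes "continuous_on UNIV f" "0 < e"
  shows "\<forall>\<^sub>F d in at_right 0. \<forall>y. (\<forall>l. \<bar>y $ l - x $ l\<bar> < d) \<longrightarrow> \<bar>f y - f x\<bar> < e"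
proof -
  have "isCont f x" using assms(1) by (simp add: continuous_on_eq_continuous_at)
  then obtain r where r: "0 < r" "\<And>y. dist y x < r \<Longrightarrow> dist (f y) (f x) < e"
    using assms(2) unfolding continuous_at_eps_delta by blast
  \<comment> \<open>The Euclidean norm is at most the sum of the absolute coordinates, hence at most
    \<open>CARD('n) * d\<close> on the cube.\<close>
  have "\<forall>\<^sub>F d in at_right 0. d < r / CARD('n)"
    using r(1) by (intro eventually_at_right_less[THEN eventually_mono] eventually_at_rightI[of 0 "r / CARD('n)"]) auto
  then show ?thesis
  proof eventually_elim
    case (elim d)
    show ?case
    proof (intro allI impI)
      fix y assume y: "\<forall>l. \<bar>y $ l - x $ l\<bar> < d"
      have "norm (y - x) \<le> (\<Sum>l\<in>UNIV. \<bar>(y - x) $ l\<bar>)" by (rule norm_le_l1_cart)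
      also have "\<dots> \<le> of_nat CARD('n) * d" using y by (intro sum_bounded_above) (simp add: less_imp_le)
      also have "\<dots> < r" using elim by (simp add: field_simps)
      finally show "\<bar>f y - f x\<bar> < e" using r(2)[of y] by (simp add: dist_norm)
    qed
  qed
qed

text \<open>A nonempty open set is not Lebesgue null, so it cannot be contained in the exceptional
  set.\<close>

lemma AE_lborel_open_ex:
  assumes "AE x in lborel. P x" "open U" "U \<noteq> {}"
  shows "\<exists>x\<in>U. P x"
proof (rule ccontr)
  assume "\<not> ?thesis"
  then have "AE x in lborel. x \<notin> U" using assms(1) by auto
  then have "U \<in> null_sets lborel" using assms(2) by (subst AE_iff_null_sets) auto
  then have "negligible U" using null_sets_completionI negligible_iff_null_sets by blast
  then show False using open_not_negligible assms by blast
qed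

lemma emeasure_lborel_square:
  assumes "0 < d"
  shows "emeasure (lborel \<Otimes>\<^sub>M lborel) ({a - d <..< a + d} \<times> {b - d <..< b + d}) = ennreal ((2 * d)\<^sup>2)"
proof -
  have "emeasure (lborel \<Otimes>\<^sub>M lborel) ({a - d <..< a + d} \<times> {b - d <..< b + d})
      = emeasure lborel {a - d <..< a + d} * emeasure lborel {b - d <..< b + d}"
    by (rule lborel.emeasure_pair_measure_Times) simp_all
  also have "\<dots> = ennreal (2 * d) * ennreal (2 * d)" using assms by simp
  also have "\<dots> = ennreal ((2 * d)\<^sup>2)" using assms by (subst ennreal_mult[symmetric]) (simp_all add: power2_eq_square)
  finally show ?thesis .
qed

section \<open>Masses and conditional probabilities on planes parallel to the two chosen
  axes\<close>

lemma insert_coords_eq_add: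
  assumes "i \<noteq> j"
  shows "insert_coords i j ((a, b), z) = insert_coords i j ((0, 0), z) + a *\<^sub>R axis i 1 + b *\<^sub>R axis j 1"
  using assms by (simp add: vec_eq_iff insert_coords_def axis_def)

lemma slice_mass_Times:
  assumes h: "\<And>a b. h ((a, b), z) = c * (\<alpha> a * \<beta> b)"
    and [measurable]: "\<alpha> \<in> borel_measurable borel" "\<beta> \<in> borel_measurable borel" "A \<in> sets borel" "B \<in> sets borel"
  shows "slice_mass (lborel \<Otimes>\<^sub>M lborel) h (A \<times> B) z =
    c * ((\<integral>\<^sup>+ a. \<alpha> a * indicator A a \<partial>lborel) * (\<integral>\<^sup>+ b. \<beta> b * indicator B b \<partial>lborel))"
proof -
  have "slice_mass (lborel \<Otimes>\<^sub>M lborel) h (A \<times> B) z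
      = (\<integral>\<^sup>+ q. c * ((\<alpha> (fst q) * indicator A (fst q)) * (\<beta> (snd q) * indicator B (snd q))) \<partial>(lborel \<Otimes>\<^sub>M lborel))"
    unfolding slice_mass_def
    by (intro nn_integral_cong) (auto simp: h split: split_indicator)
  also have "\<dots> = (\<integral>\<^sup>+ a. \<integral>\<^sup>+ b. c * ((\<alpha> a * indicator A a) * (\<beta> b * indicator B b)) \<partial>lborel \<partial>lborel)"
    by (subst lborel.nn_integral_fst[symmetric]) simp_all
  also have "\<dots> = c * ((\<integral>\<^sup>+ a. \<alpha> a * indicator A a \<partial>lborel) * (\<integral>\<^sup>+ b. \<beta> b * indicator B b \<partial>lborel))"
    by (simp add: nn_integral_cmult nn_integral_multc)
  finally show ?thesis .
qed

text \<open>A concrete version of the conditional probability that the coordinates \<open>i\<close>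
  and \<open>j\<close> fall in \<open>W\<close>, given the others. It is 0 on slices of infinite
  total mass, where \<open>enn2real\<close> makes the denominator 0.\<close>

definition fiber_prob :: "(real ^ 'n \<Rightarrow> real) \<Rightarrow> 'n \<Rightarrow> 'n \<Rightarrow> (real \<times> real) set \<Rightarrow> ('n \<Rightarrow> real) \<Rightarrow> real" where
  "fiber_prob f i j W z =
     enn2real (slice_mass (lborel \<Otimes>\<^sub>M lborel) (\<lambda>q. ennreal (f (insert_coords i j q))) W z) /
     enn2real (slice_mass (lborel \<Otimes>\<^sub>M lborel) (\<lambda>q. ennreal (f (insert_coords i j q))) UNIV z)"

text \<open>Each conditional probability agrees almost surely with a \<open>fiber_prob\<close>.
  Since \<open>f\<close> is positive, the law of \<open>X\<close> and Lebesgue measure have the same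
  null sets.\<close>

lemma cond_indep_var_iff_fiber_prob:
  fixes X :: "'w \<Rightarrow> real ^ 'p"
  assumes M: "prob_space M" and D: "distributed M lborel X (\<lambda>x. ennreal (f x))"
    and pos: "\<And>x. 0 < f x" and ij: "i \<noteq> j"
  shows "cond_indep_var M borel (\<lambda>w. X w $ i) borel (\<lambda>w. X w $ j)
           (PiM (- {i, j}) (\<lambda>_. borel)) (\<lambda>w. subvector (- {i, j}) (X w)) \<longleftrightarrow>
         (\<forall>A\<in>sets borel. \<forall>B\<in>sets borel. AE x in lborel.
            fiber_prob f i j (A \<times> B) (subvector (- {i, j}) x) =
            fiber_prob f i j (A \<times> UNIV) (subvector (- {i, j}) x) *
            fiber_prob f i j (UNIV \<times> B) (subvector (- {i, j}) x))"
proof -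
  interpret prob_space M by fact
  let ?h = "\<lambda>q. ennreal (f (insert_coords i j q))"
  let ?N = "PiM (- {i, j}) (\<lambda>_. borel)"
  define V where "V w = (X w $ i, X w $ j)" for w
  define Z where "Z w = subvector (- {i, j}) (X w)" for w
  have X [measurable]: "X \<in> measurable M borel" and f: "(\<lambda>x. ennreal (f x)) \<in> borel_measurable borel"
    using D by (auto simp: distributed_def)
  have "subvector (- {i, j}) \<in> measurable borel ?N" by (rule measurable_subvector)
  then have Z: "Z \<in> measurable M ?N" unfolding Z_def[abs_def] by (rule measurable_compose[OF X])
  note DVZ = distributed_coords[OF D ij, folded V_def Z_def]
  note sm = measurable_slice_mass[OF sigma_finite_lborel_pair distributed_borel_measurable[OF DVZ]]
  have U: "UNIV \<in> sets (lborel \<Otimes>\<^sub>M (lborel :: real measure))"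
    using sets.top[of "lborel \<Otimes>\<^sub>M (lborel :: real measure)"] by (simp add: space_pair_measure)
  have fp [measurable]: "fiber_prob f i j W \<in> borel_measurable (rest_lborel i j)"
    if "W \<in> sets (lborel \<Otimes>\<^sub>M lborel)" for W
    unfolding fiber_prob_def[abs_def] using sm[OF that] sm[OF U] by measurable
  have cp: "AE w in M. cond_prob_given M ?N Z (V -` W \<inter> space M) w = fiber_prob f i j W (Z w)"
    if "W \<in> sets (lborel \<Otimes>\<^sub>M lborel)" for W
  proof -
    \<comment> \<open>Conditioning depends on the target space of \<open>Z\<close> only through its
      measurable sets.\<close>
    have "cond_prob_given M ?N Z = cond_prob_given M (rest_lborel i j) Z"
      unfolding cond_prob_given_def using vimage_algebra_cong[OF refl refl sets_borel_rest] by metis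
    then show ?thesis
      using cond_prob_given_eq_slice_mass[OF sigma_finite_lborel_pair sigma_finite_rest_lborel DVZ that]
      by (simp add: fiber_prob_def space_pair_measure)
  qed
  have "(AE w in M. cond_prob_given M ?N Z (((\<lambda>w. X w $ i) -` A \<inter> space M) \<inter> ((\<lambda>w. X w $ j) -` B \<inter> space M)) w =
          cond_prob_given M ?N Z ((\<lambda>w. X w $ i) -` A \<inter> space M) w *
          cond_prob_given M ?N Z ((\<lambda>w. X w $ j) -` B \<inter> space M) w) \<longleftrightarrow>
        (AE x in lborel. fiber_prob f i j (A \<times> B) (subvector (- {i, j}) x) =
            fiber_prob f i j (A \<times> UNIV) (subvector (- {i, j}) x) *
            fiber_prob f i j (UNIV \<times> B) (subvector (- {i, j}) x))"
      (is "?L \<longleftrightarrow> ?R")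
    if A: "A \<in> sets borel" and B: "B \<in> sets borel" for A B
  proof -
    have sets [measurable]: "A \<times> B \<in> sets (lborel \<Otimes>\<^sub>M lborel)" "A \<times> UNIV \<in> sets (lborel \<Otimes>\<^sub>M lborel)"
        "UNIV \<times> B \<in> sets (lborel \<Otimes>\<^sub>M lborel)"
      using A B by (auto intro!: pair_measureI)
    have "((\<lambda>w. X w $ i) -` A \<inter> space M) \<inter> ((\<lambda>w. X w $ j) -` B \<inter> space M) = V -` (A \<times> B) \<inter> space M"
        "(\<lambda>w. X w $ i) -` A \<inter> space M = V -` (A \<times> UNIV) \<inter> space M"
        "(\<lambda>w. X w $ j) -` B \<inter> space M = V -` (UNIV \<times> B) \<inter> space M"
      by (auto simp: V_def)
    then have "?L \<longleftrightarrow> (AE w in M. cond_prob_given M ?N Z (V -` (A \<times> B) \<inter> space M) w =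
          cond_prob_given M ?N Z (V -` (A \<times> UNIV) \<inter> space M) w *
          cond_prob_given M ?N Z (V -` (UNIV \<times> B) \<inter> space M) w)"
      by (simp only:)
    also have "\<dots> \<longleftrightarrow> (AE w in M. fiber_prob f i j (A \<times> B) (Z w) =
        fiber_prob f i j (A \<times> UNIV) (Z w) * fiber_prob f i j (UNIV \<times> B) (Z w))"
      using cp[OF sets(1)] cp[OF sets(2)] cp[OF sets(3)]
      by (intro eventually_subst, eventually_elim) simp
    also have "\<dots> \<longleftrightarrow> ?R"
      unfolding Z_def using pos by (subst distributed_AE2[OF D]) simp_all
    finally show ?thesis .
  qed
  then show ?thesis
    using Z unfolding cond_indep_var_def Z_def[symmetric] by simp
qed

text \<open>With base point \<open>y\<close> on the slice, the rectangle identity factors the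
  density as \<open>\<alpha> a * \<beta> b / f y\<close>. Rectangle masses then factor, and
  normalising gives the product rule for every \<open>z\<close>.\<close>

lemma multiplicative_imp_fiber_prob:
  fixes f :: "real ^ 'p \<Rightarrow> real"
  assumes pos: "\<And>x. 0 < f x" and cont: "continuous_on UNIV f" and ij: "i \<noteq> j"
    and mult: "\<And>x s t. f (x + s *\<^sub>R axis i 1 + t *\<^sub>R axis j 1) * f x =
      f (x + s *\<^sub>R axis i 1) * f (x + t *\<^sub>R axis j 1)"
    and AB: "A \<in> sets borel" "B \<in> sets borel"
  shows "fiber_prob f i j (A \<times> B) z = fiber_prob f i j (A \<times> UNIV) z * fiber_prob f i j (UNIV \<times> B) z"
proof -
  define y where "y = insert_coords i j ((0, 0), z)"
  define \<alpha> where "\<alpha> a = ennreal (f (y + a *\<^sub>R axis i 1))" for a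
  define \<beta> where "\<beta> b = ennreal (f (y + b *\<^sub>R axis j 1))" for b
  have [measurable]: "f \<in> borel_measurable borel"
    using cont by (rule borel_measurable_continuous_onI)
  have [measurable]: "\<alpha> \<in> borel_measurable borel" "\<beta> \<in> borel_measurable borel"
    unfolding \<alpha>_def[abs_def] \<beta>_def[abs_def] by measurable
  have h: "ennreal (f (insert_coords i j ((a, b), z))) = ennreal (1 / f y) * (\<alpha> a * \<beta> b)" for a b
  proof -
    have "f (y + a *\<^sub>R axis i 1 + b *\<^sub>R axis j 1)
        = 1 / f y * (f (y + a *\<^sub>R axis i 1) * f (y + b *\<^sub>R axis j 1))"
      using mult[of y a b] pos[of y] by (simp add: field_simps)
    then show ?thesis
      using pos[THEN less_imp_le]
      by (subst insert_coords_eq_add[OF ij]) (simp add: \<alpha>_def \<beta>_def y_def ennreal_mult[symmetric])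
  qed
  let ?S = "\<lambda>A B. slice_mass (lborel \<Otimes>\<^sub>M lborel) (\<lambda>q. ennreal (f (insert_coords i j q))) (A \<times> B) z"
  have S: "enn2real (?S A B) = 1 / f y *
      (enn2real (\<integral>\<^sup>+ a. \<alpha> a * indicator A a \<partial>lborel) * enn2real (\<integral>\<^sup>+ b. \<beta> b * indicator B b \<partial>lborel))"
    if "A \<in> sets borel" "B \<in> sets borel" for A B
    by (subst slice_mass_Times[where h = "\<lambda>q. ennreal (f (insert_coords i j q))", OF h])
      (use that pos[of y] in \<open>simp_all add: enn2real_mult\<close>)
  have U: "slice_mass (lborel \<Otimes>\<^sub>M lborel) (\<lambda>q. ennreal (f (insert_coords i j q))) UNIV z = ?S UNIV UNIV"
    by simp
  have UNIV: "UNIV \<in> sets (borel :: real measure)" by simp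
  \<comment> \<open>With division by zero equal to 0 this also covers slices where an integral is
    infinite and \<open>enn2real\<close> returns 0.\<close>
  have cancel: "c * (a * b) / (c * (a' * b')) = c * (a * b') / (c * (a' * b')) * (c * (a' * b) / (c * (a' * b')))"
    for a b a' b' c :: real
    by (cases "c = 0"; cases "a' = 0"; cases "b' = 0") simp_all
  show ?thesis
    unfolding fiber_prob_def U S[OF AB] S[OF AB(1) UNIV] S[OF UNIV AB(2)] S[OF UNIV UNIV] by (rule cancel)
qed

text \<open>A strict violation at the four corners of a rectangle persists on small cubes around
  them. Integrating over squares in a nearby slice then contradicts the equality of products of
  masses that independence forces.\<close>

lemma fiber_prob_imp_mult_le:
  fixes f :: "real ^ 'p \<Rightarrow> real"
  assumes pos: "\<And>x. 0 < f x" and cont: "continuous_on UNIV f" and ij: "i \<noteq> j"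
    and fin: "AE x in lborel. slice_mass (lborel \<Otimes>\<^sub>M lborel) (\<lambda>q. ennreal (f (insert_coords i j q))) UNIV
                (subvector (- {i, j}) x) < \<infinity>"
    and ind: "\<And>A B. A \<in> sets borel \<Longrightarrow> B \<in> sets borel \<Longrightarrow> AE x in lborel.
            fiber_prob f i j (A \<times> B) (subvector (- {i, j}) x) =
            fiber_prob f i j (A \<times> UNIV) (subvector (- {i, j}) x) *
            fiber_prob f i j (UNIV \<times> B) (subvector (- {i, j}) x)"
  shows "f (x + s *\<^sub>R axis i 1 + t *\<^sub>R axis j 1) * f x \<le>
         f (x + s *\<^sub>R axis i 1) * f (x + t *\<^sub>R axis j 1)"
proof (rule ccontr)
  define y where "y a b = x + a *\<^sub>R axis i 1 + b *\<^sub>R axis j 1" for a b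
  assume "\<not> ?thesis"
  then have less: "f (y s 0) * f (y 0 t) < f (y s t) * f (y 0 0)" by (simp add: y_def)
  \<comment> \<open>The margin \<open>e\<close> is chosen so small that the strict inequality
    survives errors of size \<open>e\<close> at all four corners, with both lower bounds still
    positive so that they can be multiplied.\<close>
  have "((\<lambda>e. (f (y s t) - e) * (f (y 0 0) - e) - (f (y s 0) + e) * (f (y 0 t) + e))
      \<longlongrightarrow> (f (y s t) - 0) * (f (y 0 0) - 0) - (f (y s 0) + 0) * (f (y 0 t) + 0)) (at_right 0)"
    by (intro tendsto_intros)
  then have "\<forall>\<^sub>F e in at_right 0. 0 < (f (y s t) - e) * (f (y 0 0) - e) - (f (y s 0) + e) * (f (y 0 t) + e)"
    by (rule order_tendstoD) (use less in simp)
  moreover have "\<forall>\<^sub>F e in at_right 0. e < c" if "0 < c" for c :: real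
    using that by (intro eventually_at_rightI[of 0 c]) auto
  note this[OF pos[of "y s t"]] this[OF pos[of "y 0 0"]]
  moreover have "\<forall>\<^sub>F e in at_right 0. (0 :: real) < e" by (rule eventually_at_right_less)
  ultimately have "\<forall>\<^sub>F e in at_right 0. 0 < e \<and> e < f (y s t) \<and> e < f (y 0 0) \<and>
      (f (y s 0) + e) * (f (y 0 t) + e) < (f (y s t) - e) * (f (y 0 0) - e)"
    by eventually_elim auto
  then obtain e where e: "0 < e" "e < f (y s t)" "e < f (y 0 0)"
      "(f (y s 0) + e) * (f (y 0 t) + e) < (f (y s t) - e) * (f (y 0 0) - e)"
    using eventually_happens trivial_limit_at_right_real by blast
  note near = continuous_cube_nbhd[OF cont e(1)]
  have "\<forall>\<^sub>F d in at_right 0. 0 < d \<and> (\<forall>a\<in>{0, s}. \<forall>b\<in>{0, t}. \<forall>v.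
      (\<forall>l. \<bar>v $ l - y a b $ l\<bar> < d) \<longrightarrow> \<bar>f v - f (y a b)\<bar> < e)"
    using near[of "y 0 0"] near[of "y s 0"] near[of "y 0 t"] near[of "y s t"] eventually_at_right_less[of 0]
    by eventually_elim auto
  from eventually_happens'[OF trivial_limit_at_right_real this]
  obtain d where d: "0 < d" and cubes: "\<forall>a\<in>{0, s}. \<forall>b\<in>{0, t}. \<forall>v.
      (\<forall>l. \<bar>v $ l - y a b $ l\<bar> < d) \<longrightarrow> \<bar>f v - f (y a b)\<bar> < e"
    by (elim exE conjE)
  have near_d: "\<bar>f v - f (y a b)\<bar> < e"
    if "a \<in> {0, s}" "b \<in> {0, t}" "\<And>l. \<bar>v $ l - y a b $ l\<bar> < d" for a b v
    using cubes[THEN bspec, OF that(1), THEN bspec, OF that(2)] that(3) by simp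
  define I where "I a = {x $ i + a - d <..< x $ i + a + d}" for a
  define J where "J b = {x $ j + b - d <..< x $ j + b + d}" for b
  have [measurable]: "I a \<in> sets borel" "J a \<in> sets borel" for a by (simp_all add: I_def J_def)
  let ?sub = "subvector (- {i, j})"
  \<comment> \<open>Independence provides a separate null set for each pair of events; here only
    finitely many pairs occur, so one null set serves them all.\<close>
  have "AE u in lborel. (\<forall>a\<in>{0, s}. \<forall>b\<in>{0, t}. fiber_prob f i j (I a \<times> J b) (?sub u) =
            fiber_prob f i j (I a \<times> UNIV) (?sub u) * fiber_prob f i j (UNIV \<times> J b) (?sub u))"
    by (intro AE_finite_allI ind) simp_all
  with fin have "AE u in lborel. slice_mass (lborel \<Otimes>\<^sub>M lborel) (\<lambda>q. ennreal (f (insert_coords i j q))) UNIV (?sub u) < \<infinity> \<and>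
        (\<forall>a\<in>{0, s}. \<forall>b\<in>{0, t}. fiber_prob f i j (I a \<times> J b) (?sub u) =
            fiber_prob f i j (I a \<times> UNIV) (?sub u) * fiber_prob f i j (UNIV \<times> J b) (?sub u))"
    by eventually_elim blast
  moreover have "x \<in> box (x - (\<chi> l. d)) (x + (\<chi> l. d))" using d by (simp add: mem_box_cart)
  \<comment> \<open>The good points have null complement, so one of them lies in the cube around
    \<open>x\<close>. Its remaining coordinates select the slice on which masses are
    compared.\<close>
  ultimately have "\<exists>u\<in>box (x - (\<chi> l. d)) (x + (\<chi> l. d)).
      slice_mass (lborel \<Otimes>\<^sub>M lborel) (\<lambda>q. ennreal (f (insert_coords i j q))) UNIV (?sub u) < \<infinity> \<and>
        (\<forall>a\<in>{0, s}. \<forall>b\<in>{0, t}. fiber_prob f i j (I a \<times> J b) (?sub u) =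
            fiber_prob f i j (I a \<times> UNIV) (?sub u) * fiber_prob f i j (UNIV \<times> J b) (?sub u))"
    by (intro AE_lborel_open_ex open_box) auto
  then obtain u where u: "u \<in> box (x - (\<chi> l. d)) (x + (\<chi> l. d))"
    and T: "slice_mass (lborel \<Otimes>\<^sub>M lborel) (\<lambda>q. ennreal (f (insert_coords i j q))) UNIV (?sub u) < \<infinity>"
    and indu: "\<forall>a\<in>{0, s}. \<forall>b\<in>{0, t}. fiber_prob f i j (I a \<times> J b) (?sub u) =
            fiber_prob f i j (I a \<times> UNIV) (?sub u) * fiber_prob f i j (UNIV \<times> J b) (?sub u)"
    by (elim bexE conjE)
  have ux: "\<bar>u $ l - x $ l\<bar> < d" for l
  proof -
    have "x $ l - d < u $ l \<and> u $ l < x $ l + d" using u by (simp add: mem_box_cart)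
    then show ?thesis by linarith
  qed
  let ?z = "?sub u"
  define m where "m W = slice_mass (lborel \<Otimes>\<^sub>M lborel) (\<lambda>q. ennreal (f (insert_coords i j q))) W ?z" for W
  define D where "D = (2 * d)\<^sup>2"
  have D: "0 < D" using d by (simp add: D_def)
  have sq: "emeasure (lborel \<Otimes>\<^sub>M lborel) (I a \<times> J b) = ennreal D" for a b
    unfolding I_def J_def D_def using d by (rule emeasure_lborel_square)
  have IJ: "I a \<times> J b \<in> sets (lborel \<Otimes>\<^sub>M lborel)" for a b by (intro pair_measureI) simp_all
  \<comment> \<open>Coordinates \<open>i\<close> and \<open>j\<close> are close to the corner by the
    choice of \<open>v\<close>; the others come from \<open>u\<close>, which is close to
    \<open>x\<close>, and \<open>x\<close> agrees with every corner there.\<close>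
  have fb: "\<bar>f (insert_coords i j (v, ?z)) - f (y a b)\<bar> < e"
    if ab: "a \<in> {0, s}" "b \<in> {0, t}" and v: "v \<in> I a \<times> J b" for a b v
  proof (rule near_d[OF ab])
    fix l
    consider "l = i" | "l = j" | "l \<in> - {i, j}" by auto
    then show "\<bar>insert_coords i j (v, ?z) $ l - y a b $ l\<bar> < d"
    proof cases
      case 1
      then show ?thesis using v ij
        by (auto simp: insert_coords_def y_def I_def axis_def)
    next
      case 2
      then show ?thesis using v ij
        by (auto simp: insert_coords_def y_def J_def axis_def)
    next
      case 3
      then show ?thesis using ux[of l]
        by (simp add: insert_coords_def y_def axis_def subvector_def)
    qed
  qed
  have mfin: "m W < \<infinity>" for W
    using slice_mass_le_space[of "lborel \<Otimes>\<^sub>M lborel" _ W ?z] T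
    unfolding m_def by (auto simp: space_pair_measure intro: le_less_trans)
  have lower: "(f (y a b) - e) * D \<le> enn2real (m (I a \<times> J b))"
    if ab: "a \<in> {0, s}" "b \<in> {0, t}" and "e < f (y a b)" for a b
  proof -
    have "ennreal (f (y a b) - e) * emeasure (lborel \<Otimes>\<^sub>M lborel) (I a \<times> J b) \<le> m (I a \<times> J b)"
      unfolding m_def using IJ
    proof (rule slice_mass_ge)
      fix v assume "v \<in> I a \<times> J b"
      from fb[OF ab this] show "ennreal (f (y a b) - e) \<le> ennreal (f (insert_coords i j (v, ?z)))"
        by (intro ennreal_leI) linarith
    qed
    then have "ennreal ((f (y a b) - e) * D) \<le> m (I a \<times> J b)"
      using that D by (simp add: sq ennreal_mult)
    from enn2real_mono[OF this] mfin show ?thesis using that D by simp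
  qed
  have upper: "enn2real (m (I a \<times> J b)) \<le> (f (y a b) + e) * D"
    if ab: "a \<in> {0, s}" "b \<in> {0, t}" for a b
  proof -
    have "m (I a \<times> J b) \<le> ennreal (f (y a b) + e) * emeasure (lborel \<Otimes>\<^sub>M lborel) (I a \<times> J b)"
      unfolding m_def using IJ
    proof (rule slice_mass_le)
      fix v assume "v \<in> I a \<times> J b"
      from fb[OF ab this] show "ennreal (f (insert_coords i j (v, ?z))) \<le> ennreal (f (y a b) + e)"
        by (intro ennreal_leI) linarith
    qed
    also have "\<dots> = ennreal ((f (y a b) + e) * D)"
      using pos[of "y a b"] e(1) D by (simp add: sq ennreal_mult)
    finally show ?thesis
      using pos[of "y a b"] e(1) D by (intro enn2real_leI) simp_all
  qed
  \<comment> \<open>The normalising denominator must be nonzero to be cancelled. Positivity survives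
    \<open>enn2real\<close> because all masses on this slice are finite.\<close>
  have T0: "enn2real (m UNIV) > 0"
  proof -
    have "0 < (f (y s t) - e) * D" using e D by simp
    also have "\<dots> \<le> enn2real (m (I s \<times> J t))" using e by (intro lower) auto
    also have "\<dots> \<le> enn2real (m UNIV)"
      using slice_mass_le_space[of "lborel \<Otimes>\<^sub>M lborel" _ "I s \<times> J t" ?z] mfin
      by (intro enn2real_mono) (simp_all add: m_def space_pair_measure)
    finally show ?thesis .
  qed
  \<comment> \<open>Under independence both sides are the product of the same four marginal
    probabilities, those of \<open>I s\<close>, \<open>I 0\<close>, \<open>J t\<close> and
    \<open>J 0\<close>.\<close>
  have "fiber_prob f i j (I s \<times> J t) ?z * fiber_prob f i j (I 0 \<times> J 0) ?z =
        fiber_prob f i j (I s \<times> J 0) ?z * fiber_prob f i j (I 0 \<times> J t) ?z"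
    by (simp add: indu)
  then have eq: "enn2real (m (I s \<times> J t)) * enn2real (m (I 0 \<times> J 0)) =
      enn2real (m (I s \<times> J 0)) * enn2real (m (I 0 \<times> J t))"
    using T0 by (simp add: fiber_prob_def m_def[symmetric] field_simps)
  \<comment> \<open>All four squares have area \<open>D\<close>, so the bounds on masses carry the
    common factor \<open>D * D\<close> and contradict the choice of \<open>e\<close>.\<close>
  have "((f (y s t) - e) * (f (y 0 0) - e)) * (D * D) = ((f (y s t) - e) * D) * ((f (y 0 0) - e) * D)" by simp
  also have "\<dots> \<le> enn2real (m (I s \<times> J t)) * enn2real (m (I 0 \<times> J 0))"
    using e D by (intro mult_mono lower) auto
  also have "\<dots> \<le> ((f (y s 0) + e) * D) * ((f (y 0 t) + e) * D)"
    unfolding eq using pos[of "y s 0"] e(1) D by (intro mult_mono upper) auto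
  also have "\<dots> = ((f (y s 0) + e) * (f (y 0 t) + e)) * (D * D)" by simp
  also have "\<dots> < ((f (y s t) - e) * (f (y 0 0) - e)) * (D * D)"
    using e(4) D by (intro mult_strict_right_mono) auto
  finally show False by simp
qed

section \<open>Both conditions reduced to the rectangle identity\<close>

theorem proposition2:
  fixes M :: "'w measure"
    and X :: "'w \<Rightarrow> real ^ 'p"
    and f :: "real ^ 'p \<Rightarrow> real"
    and i j :: 'p
  assumes "prob_space M"
    and "distributed M lborel X (\<lambda>x. ennreal (f x))"
    and "\<And>x. 0 < f x"
    and "times_cont_diff (CARD('p) + 1) f"
    and "i \<noteq> j"
  shows "cond_indep_var M
           borel (\<lambda>w. X w $ i)
           borel (\<lambda>w. X w $ j)
           (PiM (- {i, j}) (\<lambda>_. borel)) (\<lambda>w. subvector (- {i, j}) (X w))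
         \<longleftrightarrow> (\<forall>x. diff_cumulant f i j x = 0)"
proof -
  interpret prob_space M by fact
  note D = assms(2) and pos = assms(3) and ij = assms(5)
  \<comment> \<open>The order \<open>CARD('p) + 1\<close> is at least 2, which covers the two
    differentiations in the cumulant.\<close>
  have "0 < CARD('p)" by simp
  then obtain m where "CARD('p) + 1 = Suc (Suc m)" by (auto simp: gr0_conv_Suc)
  with assms(4) have C: "times_cont_diff (Suc (Suc m)) f" by (simp only:)
  then have cont: "continuous_on UNIV f" by simp
  let ?S = "lborel \<Otimes>\<^sub>M (lborel :: real measure)" and ?h = "\<lambda>q. ennreal (f (insert_coords i j q))"
  note DVZ = distributed_coords[OF D ij]
  note DZ = distributed_slice_mass[OF sigma_finite_lborel_pair sigma_finite_rest_lborel DVZ]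
  have meas: "slice_mass ?S ?h UNIV \<in> borel_measurable (rest_lborel i j)"
    using distributed_borel_measurable[OF DZ] by (simp add: space_pair_measure)
  have "AE z in rest_lborel i j. slice_mass ?S ?h UNIV z < \<infinity>"
    using AE_slice_mass_finite[OF sigma_finite_lborel_pair sigma_finite_rest_lborel DVZ]
    by (simp add: space_pair_measure)
  \<comment> \<open>Finiteness passes from the slices to \<open>M\<close> through the density of the
    remaining coordinates, and from there to Lebesgue measure on the whole space because
    \<open>f\<close> is positive.\<close>
  then have "AE w in M. slice_mass ?S ?h UNIV (subvector (- {i, j}) (X w)) < \<infinity>"
    using meas by (subst distributed_AE2[OF DZ]) auto
  then have fin: "AE x in lborel. slice_mass ?S ?h UNIV (subvector (- {i, j}) x) < \<infinity>"
    using meas pos by (subst (asm) distributed_AE2[OF D]) simp_all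
  have "cond_indep_var M borel (\<lambda>w. X w $ i) borel (\<lambda>w. X w $ j)
           (PiM (- {i, j}) (\<lambda>_. borel)) (\<lambda>w. subvector (- {i, j}) (X w)) \<longleftrightarrow>
        (\<forall>x s t. f (x + s *\<^sub>R axis i 1 + t *\<^sub>R axis j 1) * f x =
           f (x + s *\<^sub>R axis i 1) * f (x + t *\<^sub>R axis j 1))"
    unfolding cond_indep_var_iff_fiber_prob[OF assms(1) D pos ij]
  proof
    assume "\<forall>A\<in>sets borel. \<forall>B\<in>sets borel. AE x in lborel.
            fiber_prob f i j (A \<times> B) (subvector (- {i, j}) x) =
            fiber_prob f i j (A \<times> UNIV) (subvector (- {i, j}) x) *
            fiber_prob f i j (UNIV \<times> B) (subvector (- {i, j}) x)"
    then have le: "f (x + s *\<^sub>R axis i 1 + t *\<^sub>R axis j 1) * f x \<le>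
        f (x + s *\<^sub>R axis i 1) * f (x + t *\<^sub>R axis j 1)" for x s t
      by (intro fiber_prob_imp_mult_le[OF pos cont ij fin]) auto
    show "\<forall>x s t. f (x + s *\<^sub>R axis i 1 + t *\<^sub>R axis j 1) * f x =
           f (x + s *\<^sub>R axis i 1) * f (x + t *\<^sub>R axis j 1)"
    proof (intro allI antisym le)
      fix x s t
      \<comment> \<open>Moving the base point to the adjacent corner of the rectangle reverses the inequality.\<close>
      show "f (x + s *\<^sub>R axis i 1) * f (x + t *\<^sub>R axis j 1) \<le>
          f (x + s *\<^sub>R axis i 1 + t *\<^sub>R axis j 1) * f x"
        using le[of "x + s *\<^sub>R axis i 1" "- s" t] by (simp add: algebra_simps)
    qed
  next
    assume "\<forall>x s t. f (x + s *\<^sub>R axis i 1 + t *\<^sub>R axis j 1) * f x =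
           f (x + s *\<^sub>R axis i 1) * f (x + t *\<^sub>R axis j 1)"
    then show "\<forall>A\<in>sets borel. \<forall>B\<in>sets borel. AE x in lborel.
            fiber_prob f i j (A \<times> B) (subvector (- {i, j}) x) =
            fiber_prob f i j (A \<times> UNIV) (subvector (- {i, j}) x) *
            fiber_prob f i j (UNIV \<times> B) (subvector (- {i, j}) x)"
      by (intro ballI AE_I2 multiplicative_imp_fiber_prob[OF pos cont ij]) auto
  qed
  then show ?thesis
    unfolding diff_cumulant_eq_0_iff[OF pos C] .
qed

end
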